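(* Let $(B,g_B)$ and $(F,g_F)$ be singular semi-Riemannian manifolds, $b:B\times F\to\mathbb R$ smooth, $P\in\Gamma(TB)$, and $\overline{\mathcal K}$ the semi-symmetric metric Koszul form, with respect to $P$, of the (possibly degenerate) twisted product $B\times_bF$. For all $X,Y,Z\in\Gamma(TB)$ and $U,V,W\in\Gamma(TF)$: (1) $\overline{\mathcal K}(X,Y,Z)=\overline{\mathcal K}_B(X,Y,Z)$; (2) $\overline{\mathcal K}(X,Y,W)=\overline{\mathcal K}(X,W,Y)=\overline{\mathcal K}(W,X,Y)=0$; (3) $\overline{\mathcal K}(X,V,W)=bX(b)g_F(V,W)$; (4) $\overline{\mathcal K}(V,X,W)=-\overline{\mathcal K}(V,W,X)=bX(b)g_F(V,W)+b^2g_B(X,P)g_F(V,W)$; (5) $\overline{\mathcal K}(U,V,W)=bU(b)g_F(V,W)+bV(b)g_F(W,U)-bW(b)g_F(U,V)+b^2\mathcal K_F(U,V,W)$.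
   Context: A singular semi-Riemannian manifold $(M,g)$ is a smooth manifold with a smooth symmetric bilinear form $g$ on $TM$, possibly degenerate and of variable signature. Its Koszul form is $\mathcal K(X,Y,Z)=\frac12\{X(g(Y,Z))+Y(g(Z,X))-Z(g(X,Y))-g(X,[Y,Z])+g(Y,[Z,X])+g(Z,[X,Y])\}$. For a vector field $P$ on $M$, the semi-symmetric metric Koszul form is $\overline{\mathcal K}(X,Y,Z)=\mathcal K(X,Y,Z)+g(Y,P)g(X,Z)-g(X,Y)g(P,Z)$. The twisted product $B\times_bF$ with twisting function $b:B\times F\to\mathbb R$ (smooth, possibly vanishing) is $B\times F$ with $g=\pi_B^*(g_B)+b^2\pi_F^*(g_F)$, $\pi_B,\pi_F$ the canonical projections. Vector fields in $\Gamma(TB)$, $\Gamma(TF)$ are identified with their lifts to the product, and functions and tensors on the factors with their pullbacks. Subscripts $B$, $F$ denote (lifts of) objects of that factor; $\overline{\mathcal K}_B$ is formed with $P$ on $B$. *)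

theory Defs
  imports "HOL-Analysis.Analysis"
begin

section \<open>Smooth maps between normed spaces\<close>

text \<open>
  Only used for open \<open>S\<close>. In the last clause it is enough to ask that every directional
  derivative is of class \<open>C\<^sup>k\<close>, because the spaces below are finite-dimensional.
\<close>

primrec Ck_on ::
  "nat \<Rightarrow> 'a::real_normed_vector set \<Rightarrow> ('a \<Rightarrow> 'b::real_normed_vector) \<Rightarrow> bool"
where
  "Ck_on 0 S f \<longleftrightarrow> continuous_on S f"
| "Ck_on (Suc k) S f \<longleftrightarrow>
     (\<forall>x\<in>S. f differentiable (at x)) \<and> (\<forall>v. Ck_on k S (\<lambda>x. frechet_derivative f (at x) v))"

definition smooth_on ::
  "'a::real_normed_vector set \<Rightarrow> ('a \<Rightarrow> 'b::real_normed_vector) \<Rightarrow> bool"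
where
  "smooth_on S f \<longleftrightarrow> (\<forall>k. Ck_on k S f)"


section \<open>Smooth manifolds\<close>

text \<open>
  A chart is a pair \<open>(U, \<phi>)\<close>; only the values of \<open>\<phi>\<close> on \<open>U\<close> matter. The model space is any
  finite-dimensional normed space rather than a \<^class>\<open>euclidean_space\<close>: the latter is never
  trivial and would exclude manifolds of dimension 0. The atlas need not be maximal.
\<close>

record ('m, 'e) manifold =
  mtop :: "'m topology"
  charts :: "('m set \<times> ('m \<Rightarrow> 'e)) set"

abbreviation mcarrier :: "('m, 'e) manifold \<Rightarrow> 'm set" where
  "mcarrier M \<equiv> topspace (mtop M)"

definition smooth_manifold :: "('m, 'e::real_normed_vector) manifold \<Rightarrow> bool" where
  "smooth_manifold M \<longleftrightarrow>
     (\<exists>E :: 'e set. finite E \<and> span E = UNIV) \<and>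
     Hausdorff_space (mtop M) \<and> second_countable (mtop M) \<and>
     (\<forall>(U, \<phi>) \<in> charts M. openin (mtop M) U \<and> open (\<phi> ` U) \<and>
        homeomorphic_map (subtopology (mtop M) U) (top_of_set (\<phi> ` U)) \<phi>) \<and>
     (\<Union>(U, \<phi>) \<in> charts M. U) = mcarrier M \<and>
     (\<forall>(U, \<phi>) \<in> charts M. \<forall>(V, \<psi>) \<in> charts M.
        smooth_on (\<phi> ` (U \<inter> V)) (\<psi> \<circ> inv_into U \<phi>))"

definition smooth_fun :: "('m, 'e::real_normed_vector) manifold \<Rightarrow> ('m \<Rightarrow> real) \<Rightarrow> bool" where
  "smooth_fun M f \<longleftrightarrow> (\<forall>(U, \<phi>) \<in> charts M. smooth_on (\<phi> ` U) (f \<circ> inv_into U \<phi>))"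

definition prod_manifold ::
  "('m, 'e::real_normed_vector) manifold \<Rightarrow> ('n, 'f::real_normed_vector) manifold
     \<Rightarrow> ('m \<times> 'n, 'e \<times> 'f) manifold"
where
  "prod_manifold M N =
     \<lparr>mtop = prod_topology (mtop M) (mtop N),
      charts = {(U \<times> V, map_prod \<phi> \<psi>) | U \<phi> V \<psi>. (U, \<phi>) \<in> charts M \<and> (V, \<psi>) \<in> charts N}\<rparr>"


section \<open>Tangent vectors and vector fields\<close>

text \<open>
  Tangent vectors at \<open>p\<close> are the derivations at \<open>p\<close> of the algebra of smooth functions. They are
  set to 0 on non-smooth arguments, so that a derivation is represented by exactly one HOL function.
  Smooth functions are unconstrained outside the carrier, but the Leibniz rule (applied to the
  indicator function of the complement of the carrier) forces \<open>v f\<close> to depend only on the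
  restriction of \<open>f\<close> to the carrier.
\<close>

type_synonym 'm tvec = "('m \<Rightarrow> real) \<Rightarrow> real"

definition tangent_space :: "('m, 'e::real_normed_vector) manifold \<Rightarrow> 'm \<Rightarrow> 'm tvec set" where
  "tangent_space M p =
     {v. (\<forall>f. \<not> smooth_fun M f \<longrightarrow> v f = 0) \<and>
         (\<forall>f h. smooth_fun M f \<longrightarrow> smooth_fun M h \<longrightarrow>
            (\<forall>a c. v (\<lambda>x. a * f x + c * h x) = a * v f + c * v h) \<and>
            v (\<lambda>x. f x * h x) = v f * h p + f p * v h)}"

definition vector_field ::
  "('m, 'e::real_normed_vector) manifold \<Rightarrow> ('m \<Rightarrow> 'm tvec) \<Rightarrow> bool"
where
  "vector_field M X \<longleftrightarrow>
     (\<forall>p \<in> mcarrier M. X p \<in> tangent_space M p) \<and>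
     (\<forall>f. smooth_fun M f \<longrightarrow> smooth_fun M (\<lambda>p. X p f))"

definition lie_bracket :: "('m \<Rightarrow> 'm tvec) \<Rightarrow> ('m \<Rightarrow> 'm tvec) \<Rightarrow> 'm \<Rightarrow> 'm tvec" where
  "lie_bracket X Y p = (\<lambda>f. X p (\<lambda>m. Y m f) - Y p (\<lambda>m. X m f))"

text \<open>The differential of a smooth map \<open>\<phi>\<close> into \<open>N\<close>, applied to a tangent vector.\<close>

definition differential ::
  "('n, 'f::real_normed_vector) manifold \<Rightarrow> ('m \<Rightarrow> 'n) \<Rightarrow> 'm tvec \<Rightarrow> 'n tvec"
where
  "differential N \<phi> v = (\<lambda>h. if smooth_fun N h then v (h \<circ> \<phi>) else 0)"

text \<open>
  The lift of \<open>X\<close> from a factor to the product is the field tangent to the slices of that factor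
  which projects to \<open>X\<close>, i.e. the image of \<open>X\<close> under the slice inclusions.
\<close>

definition lift_fst ::
  "('m, 'e::real_normed_vector) manifold \<Rightarrow> ('n, 'f::real_normed_vector) manifold
     \<Rightarrow> ('m \<Rightarrow> 'm tvec) \<Rightarrow> 'm \<times> 'n \<Rightarrow> ('m \<times> 'n) tvec"
where
  "lift_fst M N X = (\<lambda>(p, q). differential (prod_manifold M N) (\<lambda>x. (x, q)) (X p))"

definition lift_snd ::
  "('m, 'e::real_normed_vector) manifold \<Rightarrow> ('n, 'f::real_normed_vector) manifold
     \<Rightarrow> ('n \<Rightarrow> 'n tvec) \<Rightarrow> 'm \<times> 'n \<Rightarrow> ('m \<times> 'n) tvec"
where
  "lift_snd M N V = (\<lambda>(p, q). differential (prod_manifold M N) (\<lambda>y. (p, y)) (V q))"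


section \<open>Singular semi-Riemannian manifolds and Koszul forms\<close>

type_synonym 'm form2 = "'m \<Rightarrow> 'm tvec \<Rightarrow> 'm tvec \<Rightarrow> real"

definition singular_metric ::
  "('m, 'e::real_normed_vector) manifold \<Rightarrow> 'm form2 \<Rightarrow> bool"
where
  "singular_metric M g \<longleftrightarrow>
     (\<forall>p \<in> mcarrier M. \<forall>u \<in> tangent_space M p. \<forall>v \<in> tangent_space M p.
        g p u v = g p v u \<and>
        (\<forall>w \<in> tangent_space M p. \<forall>a c.
           g p (\<lambda>f. a * u f + c * v f) w = a * g p u w + c * g p v w)) \<and>
     (\<forall>X Y. vector_field M X \<longrightarrow> vector_field M Y \<longrightarrow> smooth_fun M (\<lambda>p. g p (X p) (Y p)))"

definition singular_semi_Riemannian ::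
  "('m, 'e::real_normed_vector) manifold \<Rightarrow> 'm form2 \<Rightarrow> bool"
where
  "singular_semi_Riemannian M g \<longleftrightarrow> smooth_manifold M \<and> singular_metric M g"

definition koszul ::
  "'m form2 \<Rightarrow> ('m \<Rightarrow> 'm tvec) \<Rightarrow> ('m \<Rightarrow> 'm tvec) \<Rightarrow> ('m \<Rightarrow> 'm tvec) \<Rightarrow> 'm \<Rightarrow> real"
where
  "koszul g X Y Z p = 1/2 *
     (X p (\<lambda>m. g m (Y m) (Z m)) + Y p (\<lambda>m. g m (Z m) (X m)) - Z p (\<lambda>m. g m (X m) (Y m))
      - g p (X p) (lie_bracket Y Z p) + g p (Y p) (lie_bracket Z X p)
      + g p (Z p) (lie_bracket X Y p))"

definition ssm_koszul ::
  "'m form2 \<Rightarrow> ('m \<Rightarrow> 'm tvec)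
     \<Rightarrow> ('m \<Rightarrow> 'm tvec) \<Rightarrow> ('m \<Rightarrow> 'm tvec) \<Rightarrow> ('m \<Rightarrow> 'm tvec) \<Rightarrow> 'm \<Rightarrow> real"
where
  "ssm_koszul g P X Y Z p =
     koszul g X Y Z p + g p (Y p) (P p) * g p (X p) (Z p) - g p (X p) (Y p) * g p (P p) (Z p)"

definition twisted_metric ::
  "('m, 'e::real_normed_vector) manifold \<Rightarrow> 'm form2
     \<Rightarrow> ('n, 'f::real_normed_vector) manifold \<Rightarrow> 'n form2
     \<Rightarrow> ('m \<times> 'n \<Rightarrow> real) \<Rightarrow> ('m \<times> 'n) form2"
where
  "twisted_metric B gB F gF b = (\<lambda>z u v.
     gB (fst z) (differential B fst u) (differential B fst v)
     + (b z)\<^sup>2 * gF (snd z) (differential F snd u) (differential F snd v))"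

end

theory Submission
  imports Defs
begin

text \<open>
  All cases of the theorem are instances of one formula. Call a field \<open>A\<close> on the product
  \<^emph>\<open>split\<close> into \<open>A\<^sub>1\<close> on \<open>B\<close> and \<open>A\<^sub>2\<close> on \<open>F\<close> if it projects to \<open>A\<^sub>1\<close> under \<^const>\<open>fst\<close> and to
  \<open>A\<^sub>2\<close> under \<^const>\<open>snd\<close>: a lift from \<open>B\<close> splits into the given field and \<open>0\<close>, a lift from \<open>F\<close>
  into \<open>0\<close> and the given field. For split fields the twisted metric is
  \<open>g(A,C) = g\<^sub>B(A\<^sub>1,C\<^sub>1) + b\<^sup>2 g\<^sub>F(A\<^sub>2,C\<^sub>2)\<close>, and the bracket of split fields again splits, into the
  brackets of the components, because brackets of \<open>\<pi>\<close>-related fields are \<open>\<pi>\<close>-related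
  (\<open>differential_lie_bracket\<close>). The product rule for \<open>b\<^sup>2\<close> then gives the Koszul form of split
  fields (\<open>koszul_twisted\<close>),
  \<open>\<K>(A,C,D) = \<K>\<^sub>B(A\<^sub>1,C\<^sub>1,D\<^sub>1) + b\<^sup>2 \<K>\<^sub>F(A\<^sub>2,C\<^sub>2,D\<^sub>2)
    + b (A(b) g\<^sub>F(C\<^sub>2,D\<^sub>2) + C(b) g\<^sub>F(D\<^sub>2,A\<^sub>2) - D(b) g\<^sub>F(A\<^sub>2,C\<^sub>2))\<close>.
  The semi-symmetric correction consists of products of metric values, and there the lift of \<open>P\<close>
  has the components \<open>P\<close> and \<open>0\<close>. Since a metric and its Koszul form vanish as soon as one argument
  is the zero field, substituting the components of the lifts leaves exactly the terms in the
  statement.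

  The analytic work is in showing that the objects are smooth where the product rule needs it:
  a tangent vector gives 0 on functions that are not smooth. Pullbacks along the projections and
  restrictions to slices have to preserve smoothness, and functions known only on the carrier have
  to be interchangeable under a derivation (\<open>tangent_cong\<close>).
\<close>


section \<open>Calculus of \<open>C\<^sup>k\<close> functions on open sets\<close>

lemma Ck_on_cong:
  assumes "open S" and "\<And>x. x \<in> S \<Longrightarrow> f x = h x" and "Ck_on k S f"
  shows "Ck_on k S h"
  using assms(2,3)
proof (induction k arbitrary: f h)
  case 0
  then show ?case by (simp cong: continuous_on_cong)
next
  case (Suc k)
  have D: "(h has_derivative frechet_derivative f (at x)) (at x)" if "x \<in> S" for x
    using Suc.prems that \<open>open S\<close>
    by (auto simp: frechet_derivative_works intro: has_derivative_transform_within_open)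
  have "Ck_on k S (\<lambda>x. frechet_derivative h (at x) v)" for v
    using Suc.IH[of "\<lambda>x. frechet_derivative f (at x) v"] Suc.prems frechet_derivative_at[OF D]
    by simp
  then show ?case
    using D by (auto simp: differentiable_def)
qed

text \<open>
  Any pointwise derivative on \<open>S\<close> may replace the chosen \<^const>\<open>frechet_derivative\<close>; the inductions
  below all run through this rule.
\<close>

lemma Ck_on_SucI:
  assumes "open S" and D: "\<And>x. x \<in> S \<Longrightarrow> (f has_derivative D x) (at x)"
    and "\<And>v. Ck_on k S (\<lambda>x. D x v)"
  shows "Ck_on (Suc k) S f"
proof -
  have "Ck_on k S (\<lambda>x. frechet_derivative f (at x) v)" for v
    by (rule Ck_on_cong[OF assms(1) _ assms(3)[of v]]) (simp add: frechet_derivative_at[OF D])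
  then show ?thesis
    using D by (auto simp: differentiable_def)
qed

lemma Ck_on_SucD:
  assumes "Ck_on (Suc k) S f"
  shows "x \<in> S \<Longrightarrow> (f has_derivative frechet_derivative f (at x)) (at x)"
    and "Ck_on k S (\<lambda>x. frechet_derivative f (at x) v)"
  using assms by (auto simp: frechet_derivative_works)

lemma Ck_on_Suc_imp: "Ck_on (Suc k) S f \<Longrightarrow> Ck_on k S f"
proof (induction k arbitrary: f)
  case 0
  then show ?case
    by (auto intro: differentiable_imp_continuous_within continuous_at_imp_continuous_on)
next
  case (Suc k)
  then show ?case by (metis Ck_on.simps(2))
qed

lemma Ck_on_const: "open S \<Longrightarrow> Ck_on k S (\<lambda>_. c)"
proof (induction k arbitrary: c)
  case (Suc k)
  then show ?case
    by (intro Ck_on_SucI[where D="\<lambda>_ _. 0"]) auto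
qed simp

lemma Ck_on_linear_combination:
  fixes f h :: "'a::real_normed_vector \<Rightarrow> real"
  assumes "open S"
  shows "Ck_on k S f \<Longrightarrow> Ck_on k S h \<Longrightarrow> Ck_on k S (\<lambda>x. a * f x + c * h x)"
proof (induction k arbitrary: f h)
  case 0
  then show ?case by (auto intro!: continuous_intros)
next
  case (Suc k)
  note f = Ck_on_SucD[OF Suc.prems(1)] and h = Ck_on_SucD[OF Suc.prems(2)]
  show ?case
  proof (rule Ck_on_SucI[OF \<open>open S\<close>])
    show "((\<lambda>x. a * f x + c * h x) has_derivative
        (\<lambda>v. a * frechet_derivative f (at x) v + c * frechet_derivative h (at x) v)) (at x)"
      if "x \<in> S" for x
      using f(1)[OF that] h(1)[OF that] by (auto intro!: derivative_intros)
  qed (use Suc.IH f(2) h(2) in blast)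
qed

lemma Ck_on_mult:
  fixes f h :: "'a::real_normed_vector \<Rightarrow> real"
  assumes "open S"
  shows "Ck_on k S f \<Longrightarrow> Ck_on k S h \<Longrightarrow> Ck_on k S (\<lambda>x. f x * h x)"
proof (induction k arbitrary: f h)
  case 0
  then show ?case by (auto intro!: continuous_intros)
next
  case (Suc k)
  note f = Ck_on_SucD[OF Suc.prems(1)] and h = Ck_on_SucD[OF Suc.prems(2)]
  show ?case
  proof (rule Ck_on_SucI[OF \<open>open S\<close>])
    show "((\<lambda>x. f x * h x) has_derivative
        (\<lambda>v. f x * frechet_derivative h (at x) v + frechet_derivative f (at x) v * h x)) (at x)"
      if "x \<in> S" for x
      by (rule has_derivative_mult[OF f(1)[OF that] h(1)[OF that]])
    show "Ck_on k S (\<lambda>x. f x * frechet_derivative h (at x) v + frechet_derivative f (at x) v * h x)"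
      for v
      using Ck_on_linear_combination[OF \<open>open S\<close>, of k
          "\<lambda>x. f x * frechet_derivative h (at x) v" "\<lambda>x. frechet_derivative f (at x) v * h x" 1 1]
        Suc.IH f(2) h(2) Suc.prems[THEN Ck_on_Suc_imp] by simp
  qed
qed

text \<open>
  Both the projections of a product and the inclusions of its slices are affine, and \<open>C\<^sup>k\<close> functions
  pull back along a continuous affine map because its derivative is constant.
\<close>

lemma Ck_on_compose_affine:
  assumes "open S" and "bounded_linear L" and "\<And>x. x \<in> S \<Longrightarrow> L x + c \<in> T"
  shows "Ck_on k T f \<Longrightarrow> Ck_on k S (\<lambda>x. f (L x + c))"
proof (induction k arbitrary: f)
  case 0
  have "continuous_on S (\<lambda>x. L x + c)"
    using linear_continuous_on[OF assms(2)] by (intro continuous_intros)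
  then show ?case
    using 0 assms(3) continuous_on_compose2[of T f S "\<lambda>x. L x + c"] by auto
next
  case (Suc k)
  note f = Ck_on_SucD[OF Suc.prems]
  show ?case
  proof (rule Ck_on_SucI[OF \<open>open S\<close>])
    show "((\<lambda>x. f (L x + c)) has_derivative (\<lambda>v. frechet_derivative f (at (L x + c)) (L v))) (at x)"
      if "x \<in> S" for x
    proof (rule has_derivative_compose[of "\<lambda>x. L x + c"])
      show "((\<lambda>x. L x + c) has_derivative L) (at x)"
        using bounded_linear_imp_has_derivative[OF assms(2)] by (auto intro!: derivative_eq_intros)
    qed (use f(1) assms(3) that in blast)
  qed (use Suc.IH[OF f(2)] in blast)
qed


section \<open>Smooth functions on manifolds and their products\<close>

text \<open>
  What makes the calculus of the previous section applicable to the coordinate expressions of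
  functions on \<open>M\<close>: chart images are open, and charts cover \<open>M\<close> and can be inverted. Products inherit
  this directly.
\<close>

definition charted :: "('m, 'e::real_normed_vector) manifold \<Rightarrow> bool" where
  "charted M \<longleftrightarrow>
     (\<forall>(U, \<phi>) \<in> charts M. open (\<phi> ` U) \<and> inj_on \<phi> U) \<and>
     (\<Union>(U, \<phi>) \<in> charts M. U) = mcarrier M"

lemma smooth_manifold_charted: "smooth_manifold M \<Longrightarrow> charted M"
proof -
  assume M: "smooth_manifold M"
  have "inj_on \<phi> U" if "(U, \<phi>) \<in> charts M" for U \<phi>
  proof -
    have "openin (mtop M) U"
      and "homeomorphic_map (subtopology (mtop M) U) (top_of_set (\<phi> ` U)) \<phi>"
      using M that by (auto simp: smooth_manifold_def)
    then show ?thesis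
      using homeomorphic_imp_injective_map
      by (metis openin_subset topspace_subtopology_subset)
  qed
  then show ?thesis
    using M by (fastforce simp: smooth_manifold_def charted_def)
qed

lemma chartedD:
  assumes "charted M" and "(U, \<phi>) \<in> charts M"
  shows "open (\<phi> ` U)" and "inj_on \<phi> U" and "U \<subseteq> mcarrier M"
  using assms unfolding charted_def by fastforce+

lemma mcarrier_prod: "mcarrier (prod_manifold M N) = mcarrier M \<times> mcarrier N"
  by (simp add: prod_manifold_def)

lemma charts_prodE:
  assumes "c \<in> charts (prod_manifold M N)"
  obtains U \<phi> V \<psi> where "c = (U \<times> V, map_prod \<phi> \<psi>)" "(U, \<phi>) \<in> charts M" "(V, \<psi>) \<in> charts N"
  using assms by (auto simp: prod_manifold_def)

lemma charted_prod:
  assumes "charted M" and "charted N"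
  shows "charted (prod_manifold M N)"
proof -
  have "open (\<xi> ` W) \<and> inj_on \<xi> W" if "(W, \<xi>) \<in> charts (prod_manifold M N)" for W \<xi>
    using that
  proof (rule charts_prodE)
    fix U \<phi> V \<psi>
    assume "(W, \<xi>) = (U \<times> V, map_prod \<phi> \<psi>)" "(U, \<phi>) \<in> charts M" "(V, \<psi>) \<in> charts N"
    then show ?thesis
      using chartedD[OF assms(1)] chartedD[OF assms(2)]
      by (auto simp: map_prod_surj_on[OF refl refl] open_Times map_prod_inj_on)
  qed
  moreover have "(\<Union>(W, \<xi>) \<in> charts (prod_manifold M N). W)
      = (\<Union>(U, \<phi>) \<in> charts M. U) \<times> (\<Union>(V, \<psi>) \<in> charts N. V)"
    unfolding prod_manifold_def by simp blast
  ultimately show ?thesis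
    using assms by (auto simp: charted_def mcarrier_prod)
qed

lemma inv_into_map_prod:
  assumes "inj_on \<phi> U" and "inj_on \<psi> V" and "x \<in> \<phi> ` U" and "y \<in> \<psi> ` V"
  shows "inv_into (U \<times> V) (map_prod \<phi> \<psi>) (x, y) = (inv_into U \<phi> x, inv_into V \<psi> y)"
  using assms by (auto intro!: inv_into_f_eq simp: map_prod_inj_on)

lemma smooth_fun_cong:
  assumes "charted M" and "\<And>x. x \<in> mcarrier M \<Longrightarrow> f x = h x" and "smooth_fun M f"
  shows "smooth_fun M h"
  unfolding smooth_fun_def smooth_on_def
proof clarify
  fix U \<phi> k
  assume c: "(U, \<phi>) \<in> charts M"
  note C = chartedD[OF assms(1) c]
  have "Ck_on k (\<phi> ` U) (f \<circ> inv_into U \<phi>)"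
    using assms(3) c by (auto simp: smooth_fun_def smooth_on_def)
  then show "Ck_on k (\<phi> ` U) (h \<circ> inv_into U \<phi>)"
    by (rule Ck_on_cong[OF C(1), rotated]) (use C assms(2) in auto)
qed

lemma smooth_fun_const: "charted M \<Longrightarrow> smooth_fun M (\<lambda>_. c)"
  using chartedD(1) by (fastforce simp: smooth_fun_def smooth_on_def o_def intro: Ck_on_const)

lemma smooth_fun_linear_combination:
  assumes "charted M" and "smooth_fun M f" and "smooth_fun M h"
  shows "smooth_fun M (\<lambda>x. a * f x + c * h x)"
  using assms(2,3) chartedD(1)[OF assms(1)]
  by (fastforce simp: smooth_fun_def smooth_on_def o_def intro: Ck_on_linear_combination)

lemma smooth_fun_mult:
  assumes "charted M" and "smooth_fun M f" and "smooth_fun M h"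
  shows "smooth_fun M (\<lambda>x. f x * h x)"
  using assms(2,3) chartedD(1)[OF assms(1)]
  by (fastforce simp: smooth_fun_def smooth_on_def o_def intro: Ck_on_mult)

lemma smooth_fun_fst:
  assumes "charted M" and "charted N" and "smooth_fun M f"
  shows "smooth_fun (prod_manifold M N) (f \<circ> fst)"
  unfolding smooth_fun_def smooth_on_def
proof clarify
  fix W \<xi> k
  assume "(W, \<xi>) \<in> charts (prod_manifold M N)"
  then obtain U \<phi> V \<psi> where W: "W = U \<times> V" "\<xi> = map_prod \<phi> \<psi>"
    and c: "(U, \<phi>) \<in> charts M" and d: "(V, \<psi>) \<in> charts N"
    by (auto elim: charts_prodE)
  note C = chartedD[OF assms(1) c] and D = chartedD[OF assms(2) d]
  have op: "open (\<phi> ` U \<times> \<psi> ` V)"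
    using C D by (simp add: open_Times)
  have "Ck_on k (\<phi> ` U) (f \<circ> inv_into U \<phi>)"
    using assms(3) c by (auto simp: smooth_fun_def smooth_on_def)
  then have "Ck_on k (\<phi> ` U \<times> \<psi> ` V) (\<lambda>z. (f \<circ> inv_into U \<phi>) (fst z + 0))"
    by (rule Ck_on_compose_affine[OF op bounded_linear_fst, rotated]) auto
  then have "Ck_on k (\<phi> ` U \<times> \<psi> ` V) (f \<circ> fst \<circ> inv_into W \<xi>)"
    by (rule Ck_on_cong[OF op, rotated]) (auto simp: W inv_into_map_prod C D)
  then show "Ck_on k (\<xi> ` W) (f \<circ> fst \<circ> inv_into W \<xi>)"
    by (simp add: W map_prod_surj_on[OF refl refl])
qed

lemma smooth_fun_snd:
  assumes "charted M" and "charted N" and "smooth_fun N f"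
  shows "smooth_fun (prod_manifold M N) (f \<circ> snd)"
  unfolding smooth_fun_def smooth_on_def
proof clarify
  fix W \<xi> k
  assume "(W, \<xi>) \<in> charts (prod_manifold M N)"
  then obtain U \<phi> V \<psi> where W: "W = U \<times> V" "\<xi> = map_prod \<phi> \<psi>"
    and c: "(U, \<phi>) \<in> charts M" and d: "(V, \<psi>) \<in> charts N"
    by (auto elim: charts_prodE)
  note C = chartedD[OF assms(1) c] and D = chartedD[OF assms(2) d]
  have op: "open (\<phi> ` U \<times> \<psi> ` V)"
    using C D by (simp add: open_Times)
  have "Ck_on k (\<psi> ` V) (f \<circ> inv_into V \<psi>)"
    using assms(3) d by (auto simp: smooth_fun_def smooth_on_def)
  then have "Ck_on k (\<phi> ` U \<times> \<psi> ` V) (\<lambda>z. (f \<circ> inv_into V \<psi>) (snd z + 0))"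
    by (rule Ck_on_compose_affine[OF op bounded_linear_snd, rotated]) auto
  then have "Ck_on k (\<phi> ` U \<times> \<psi> ` V) (f \<circ> snd \<circ> inv_into W \<xi>)"
    by (rule Ck_on_cong[OF op, rotated]) (auto simp: W inv_into_map_prod C D)
  then show "Ck_on k (\<xi> ` W) (f \<circ> snd \<circ> inv_into W \<xi>)"
    by (simp add: W map_prod_surj_on[OF refl refl])
qed

text \<open>
  To test \<open>f(\<cdot>, q)\<close> in a chart of \<open>M\<close>, pair that chart with one of \<open>N\<close> around \<open>q\<close>: in the
  resulting product chart the slice is an affine subspace.
\<close>

lemma smooth_fun_slice_fst:
  assumes "charted M" and "charted N" and "smooth_fun (prod_manifold M N) f" and "q \<in> mcarrier N"
  shows "smooth_fun M (f \<circ> (\<lambda>x. (x, q)))"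
  unfolding smooth_fun_def smooth_on_def
proof clarify
  fix U \<phi> k
  assume c: "(U, \<phi>) \<in> charts M"
  obtain V \<psi> where d: "(V, \<psi>) \<in> charts N" and q: "q \<in> V"
    using assms(2,4) unfolding charted_def by blast
  note C = chartedD[OF assms(1) c] and D = chartedD[OF assms(2) d]
  have "(U \<times> V, map_prod \<phi> \<psi>) \<in> charts (prod_manifold M N)"
    using c d by (auto simp: prod_manifold_def)
  then have "Ck_on k (\<phi> ` U \<times> \<psi> ` V) (f \<circ> inv_into (U \<times> V) (map_prod \<phi> \<psi>))"
    using assms(3) by (auto simp: smooth_fun_def smooth_on_def simp flip: map_prod_surj_on[OF refl refl])
  then have "Ck_on k (\<phi> ` U) (\<lambda>a. (f \<circ> inv_into (U \<times> V) (map_prod \<phi> \<psi>)) ((a, 0) + (0, \<psi> q)))"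
    by (rule Ck_on_compose_affine[OF C(1), rotated 2])
      (use q in \<open>auto intro: bounded_linear_Pair bounded_linear_ident bounded_linear_zero\<close>)
  then show "Ck_on k (\<phi> ` U) (f \<circ> (\<lambda>x. (x, q)) \<circ> inv_into U \<phi>)"
    by (rule Ck_on_cong[OF C(1), rotated]) (use q in \<open>auto simp: inv_into_map_prod C D\<close>)
qed

lemma smooth_fun_slice_snd:
  assumes "charted M" and "charted N" and "smooth_fun (prod_manifold M N) f" and "p \<in> mcarrier M"
  shows "smooth_fun N (f \<circ> (\<lambda>y. (p, y)))"
  unfolding smooth_fun_def smooth_on_def
proof clarify
  fix V \<psi> k
  assume d: "(V, \<psi>) \<in> charts N"
  obtain U \<phi> where c: "(U, \<phi>) \<in> charts M" and p: "p \<in> U"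
    using assms(1,4) unfolding charted_def by blast
  note C = chartedD[OF assms(1) c] and D = chartedD[OF assms(2) d]
  have "(U \<times> V, map_prod \<phi> \<psi>) \<in> charts (prod_manifold M N)"
    using c d by (auto simp: prod_manifold_def)
  then have "Ck_on k (\<phi> ` U \<times> \<psi> ` V) (f \<circ> inv_into (U \<times> V) (map_prod \<phi> \<psi>))"
    using assms(3) by (auto simp: smooth_fun_def smooth_on_def simp flip: map_prod_surj_on[OF refl refl])
  then have "Ck_on k (\<psi> ` V) (\<lambda>a. (f \<circ> inv_into (U \<times> V) (map_prod \<phi> \<psi>)) ((0, a) + (\<phi> p, 0)))"
    by (rule Ck_on_compose_affine[OF D(1), rotated 2])
      (use p in \<open>auto intro: bounded_linear_Pair bounded_linear_ident bounded_linear_zero\<close>)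
  then show "Ck_on k (\<psi> ` V) (f \<circ> (\<lambda>y. (p, y)) \<circ> inv_into V \<psi>)"
    by (rule Ck_on_cong[OF D(1), rotated]) (use p in \<open>auto simp: inv_into_map_prod C D\<close>)
qed


section \<open>Tangent vectors, differentials and brackets\<close>

lemma tangent_not_smooth: "v \<in> tangent_space M p \<Longrightarrow> \<not> smooth_fun M f \<Longrightarrow> v f = 0"
  by (simp add: tangent_space_def)

lemma tangent_linear:
  "v \<in> tangent_space M p \<Longrightarrow> smooth_fun M f \<Longrightarrow> smooth_fun M h \<Longrightarrow>
    v (\<lambda>x. a * f x + c * h x) = a * v f + c * v h"
  by (simp add: tangent_space_def)

lemma tangent_mult:
  "v \<in> tangent_space M p \<Longrightarrow> smooth_fun M f \<Longrightarrow> smooth_fun M h \<Longrightarrow>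
    v (\<lambda>x. f x * h x) = v f * h p + f p * v h"
  by (simp add: tangent_space_def)

lemma zero_in_tangent_space: "(\<lambda>_. 0) \<in> tangent_space M p"
  by (simp add: tangent_space_def)

lemma tangent_const:
  assumes "charted M" and v: "v \<in> tangent_space M p"
  shows "v (\<lambda>_. c) = 0"
proof -
  note one = smooth_fun_const[OF assms(1), of 1]
  have "v (\<lambda>_. 1) = 0"
    using tangent_mult[OF v one one] by simp
  then show ?thesis
    using tangent_linear[OF v one one, of c 0] by simp
qed

text \<open>
  A function \<open>d\<close> that vanishes on the carrier equals \<open>d \<cdot> \<xi>\<close> for the indicator \<open>\<xi>\<close> of the complement.
  For smooth \<open>f\<close> and \<open>h\<close>, this applies to \<open>d = f - h\<close>: both factors are smooth and vanish at \<open>p\<close>, so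
  the Leibniz rule gives \<open>v d = 0\<close>. Otherwise neither is smooth, and both values are 0 by convention.
\<close>

lemma tangent_cong:
  assumes M: "charted M" and p: "p \<in> mcarrier M" and v: "v \<in> tangent_space M p"
    and eq: "\<And>x. x \<in> mcarrier M \<Longrightarrow> f x = h x"
  shows "v f = v h"
proof (cases "smooth_fun M f")
  case False
  then have "\<not> smooth_fun M h"
    using smooth_fun_cong[OF M, of h f] eq by auto
  then show ?thesis
    using False tangent_not_smooth[OF v] by simp
next
  case f: True
  define \<xi> :: "'a \<Rightarrow> real" where "\<xi> x = (if x \<in> mcarrier M then 0 else 1)" for x
  define d where "d x = 1 * f x + (- 1) * h x" for x
  have h: "smooth_fun M h"
    using smooth_fun_cong[OF M eq f] .
  have d: "smooth_fun M d"
    unfolding d_def by (rule smooth_fun_linear_combination[OF M f h])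
  have \<xi>: "smooth_fun M \<xi>"
    by (rule smooth_fun_cong[OF M _ smooth_fun_const[OF M, of 0]]) (simp add: \<xi>_def)
  have "d = (\<lambda>x. d x * \<xi> x)"
    using eq by (auto simp: \<xi>_def d_def)
  then have "v d = v d * \<xi> p + d p * v \<xi>"
    using tangent_mult[OF v d \<xi>] by metis
  then have "v d = 0"
    using p eq by (simp add: \<xi>_def d_def)
  then show ?thesis
    using tangent_linear[OF v f h, of 1 "- 1"] by (simp add: d_def[abs_def])
qed

lemma vector_field_tangent: "vector_field M X \<Longrightarrow> p \<in> mcarrier M \<Longrightarrow> X p \<in> tangent_space M p"
  by (simp add: vector_field_def)

lemma vector_field_smooth: "vector_field M X \<Longrightarrow> smooth_fun M f \<Longrightarrow> smooth_fun M (\<lambda>p. X p f)"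
  by (simp add: vector_field_def)

lemma vector_field_zero: "charted M \<Longrightarrow> vector_field M (\<lambda>_ _. 0)"
  by (simp add: vector_field_def zero_in_tangent_space smooth_fun_const)

lemma lie_bracket_tangent:
  assumes M: "charted M" and X: "vector_field M X" and Y: "vector_field M Y" and p: "p \<in> mcarrier M"
  shows "lie_bracket X Y p \<in> tangent_space M p"
proof -
  note Xp = vector_field_tangent[OF X] and Yp = vector_field_tangent[OF Y]
  have half_linear: "v (\<lambda>m. T m (\<lambda>x. a * f x + c * h x)) = a * v (\<lambda>m. T m f) + c * v (\<lambda>m. T m h)"
    if "vector_field M T" "v \<in> tangent_space M p" "smooth_fun M f" "smooth_fun M h" for T v f h a c
  proof -
    have "v (\<lambda>m. T m (\<lambda>x. a * f x + c * h x)) = v (\<lambda>m. a * T m f + c * T m h)"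
      by (rule tangent_cong[OF M p that(2)]) (rule tangent_linear[OF vector_field_tangent]; use that in simp)
    then show ?thesis
      by (simp add: tangent_linear[OF that(2)] vector_field_smooth that)
  qed
  have half_mult: "v (\<lambda>m. T m (\<lambda>x. f x * h x))
      = v (\<lambda>m. T m f) * h p + T p f * v h + v f * T p h + f p * v (\<lambda>m. T m h)"
    if "vector_field M T" "v \<in> tangent_space M p" "smooth_fun M f" "smooth_fun M h" for T v f h
  proof -
    have "v (\<lambda>m. T m (\<lambda>x. f x * h x)) = v (\<lambda>m. 1 * (T m f * h m) + 1 * (f m * T m h))"
      by (rule tangent_cong[OF M p that(2)])
        (use that in \<open>simp add: tangent_mult[OF vector_field_tangent]\<close>)
    also have "\<dots> = 1 * v (\<lambda>m. T m f * h m) + 1 * v (\<lambda>m. f m * T m h)"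
      by (rule tangent_linear[OF that(2)]) (simp_all add: smooth_fun_mult[OF M] vector_field_smooth that)
    finally show ?thesis
      by (simp add: tangent_mult[OF that(2)] vector_field_smooth that)
  qed
  have half_zero: "v (\<lambda>m. T m f) = 0"
    if "vector_field M T" "v \<in> tangent_space M p" "\<not> smooth_fun M f" for T v f
  proof -
    have "v (\<lambda>m. T m f) = v (\<lambda>_. 0)"
      by (rule tangent_cong[OF M p that(2)])
        (rule tangent_not_smooth[OF vector_field_tangent[OF that(1)] that(3)])
    then show ?thesis
      by (simp add: tangent_const[OF M that(2)])
  qed
  show ?thesis
    unfolding tangent_space_def lie_bracket_def
    by (auto simp: half_zero[OF X Yp[OF p]] half_zero[OF Y Xp[OF p]]
        half_linear[OF X Yp[OF p]] half_linear[OF Y Xp[OF p]]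
        half_mult[OF X Yp[OF p]] half_mult[OF Y Xp[OF p]] algebra_simps)
qed

lemma lie_bracket_zero:
  assumes "charted M" and "vector_field M X" and "p \<in> mcarrier M"
  shows "lie_bracket X (\<lambda>_ _. 0) p = (\<lambda>_. 0)" and "lie_bracket (\<lambda>_ _. 0) X p = (\<lambda>_. 0)"
  using tangent_const[OF assms(1) vector_field_tangent[OF assms(2,3)]]
  by (simp_all add: lie_bracket_def)

lemma differential_tangent:
  assumes "charted N" and "v \<in> tangent_space M p"
    and "\<And>h. smooth_fun N h \<Longrightarrow> smooth_fun M (h \<circ> \<pi>)"
  shows "differential N \<pi> v \<in> tangent_space N (\<pi> p)"
  unfolding tangent_space_def
  using tangent_linear[OF assms(2) assms(3) assms(3)] tangent_mult[OF assms(2) assms(3) assms(3)]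
    smooth_fun_linear_combination[OF assms(1)] smooth_fun_mult[OF assms(1)]
  by (simp add: differential_def o_def)

lemma differential_compose:
  assumes "\<And>h. smooth_fun N h \<Longrightarrow> smooth_fun M (h \<circ> \<pi>)"
  shows "differential N \<pi> (differential M \<iota> v) = differential N (\<pi> \<circ> \<iota>) v"
  using assms by (auto simp: differential_def o_assoc)

lemma differential_id: "v \<in> tangent_space M p \<Longrightarrow> differential M (\<lambda>x. x) v = v"
  by (auto simp: differential_def o_def tangent_not_smooth)

lemma differential_const:
  "charted M \<Longrightarrow> v \<in> tangent_space M p \<Longrightarrow> differential N (\<lambda>_. c) v = (\<lambda>_. 0)"
  by (auto simp: differential_def o_def tangent_const)

text \<open>
  Relatedness says \<open>Y'(h \<circ> \<pi>) = (Y h) \<circ> \<pi>\<close>; applying \<open>X'\<close> and using relatedness once more gives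
  \<open>X'(Y'(h \<circ> \<pi>)) = (X (Y h)) \<circ> \<pi>\<close>. The first identity holds on the carrier only, which is why
  \<open>tangent_cong\<close> is needed before \<open>X'\<close> can be applied to it.
\<close>

lemma differential_lie_bracket:
  assumes M: "charted M" and N: "charted N" and z: "z \<in> mcarrier M"
    and pull: "\<And>h. smooth_fun N h \<Longrightarrow> smooth_fun M (h \<circ> \<pi>)"
    and \<pi>: "\<And>z. z \<in> mcarrier M \<Longrightarrow> \<pi> z \<in> mcarrier N"
    and X': "\<And>z. z \<in> mcarrier M \<Longrightarrow> X' z \<in> tangent_space M z"
    and Y': "\<And>z. z \<in> mcarrier M \<Longrightarrow> Y' z \<in> tangent_space M z"
    and dX: "\<And>z. z \<in> mcarrier M \<Longrightarrow> differential N \<pi> (X' z) = X (\<pi> z)"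
    and dY: "\<And>z. z \<in> mcarrier M \<Longrightarrow> differential N \<pi> (Y' z) = Y (\<pi> z)"
    and X: "vector_field N X" and Y: "vector_field N Y"
  shows "differential N \<pi> (lie_bracket X' Y' z) = lie_bracket X Y (\<pi> z)"
proof
  have related: "S z (\<lambda>m. T m (h \<circ> \<pi>)) = S\<^sub>0 (\<pi> z) (\<lambda>m. T\<^sub>0 m h)"
    if h: "smooth_fun N h" and S: "S z \<in> tangent_space M z"
      and dS: "differential N \<pi> (S z) = S\<^sub>0 (\<pi> z)"
      and dT: "\<And>z. z \<in> mcarrier M \<Longrightarrow> differential N \<pi> (T z) = T\<^sub>0 (\<pi> z)"
      and T\<^sub>0: "vector_field N T\<^sub>0" for S T S\<^sub>0 T\<^sub>0 h
  proof -
    have "T m (h \<circ> \<pi>) = T\<^sub>0 (\<pi> m) h" if "m \<in> mcarrier M" for m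
      using h fun_cong[OF dT[OF that], of h] by (simp add: differential_def)
    then have "S z (\<lambda>m. T m (h \<circ> \<pi>)) = S z ((\<lambda>m. T\<^sub>0 m h) \<circ> \<pi>)"
      by (intro tangent_cong[OF M z S]) simp
    also have "\<dots> = S\<^sub>0 (\<pi> z) (\<lambda>m. T\<^sub>0 m h)"
      using fun_cong[OF dS, of "\<lambda>m. T\<^sub>0 m h"] vector_field_smooth[OF T\<^sub>0 h]
      by (simp add: differential_def)
    finally show ?thesis .
  qed
  fix h
  show "differential N \<pi> (lie_bracket X' Y' z) h = lie_bracket X Y (\<pi> z) h"
  proof (cases "smooth_fun N h")
    case True
    have "differential N \<pi> (lie_bracket X' Y' z) h
        = X' z (\<lambda>m. Y' m (h \<circ> \<pi>)) - Y' z (\<lambda>m. X' m (h \<circ> \<pi>))"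
      using True by (simp add: differential_def lie_bracket_def)
    then show ?thesis
      using related[OF True, of X' X Y' Y] related[OF True, of Y' Y X' X] assms
      by (simp add: lie_bracket_def)
  next
    case False
    then show ?thesis
      using tangent_not_smooth[OF lie_bracket_tangent[OF N X Y \<pi>[OF z]]]
      by (simp add: differential_def)
  qed
qed


section \<open>Degenerate metrics and their Koszul forms\<close>

lemma metric_sym:
  "singular_metric M g \<Longrightarrow> p \<in> mcarrier M \<Longrightarrow> u \<in> tangent_space M p \<Longrightarrow> v \<in> tangent_space M p \<Longrightarrow>
    g p u v = g p v u"
  by (simp add: singular_metric_def)

lemma metric_linear:
  "singular_metric M g \<Longrightarrow> p \<in> mcarrier M \<Longrightarrow> u \<in> tangent_space M p \<Longrightarrow> v \<in> tangent_space M p \<Longrightarrow>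
    w \<in> tangent_space M p \<Longrightarrow> g p (\<lambda>f. a * u f + c * v f) w = a * g p u w + c * g p v w"
  by (simp add: singular_metric_def)

lemma metric_smooth:
  "singular_metric M g \<Longrightarrow> vector_field M X \<Longrightarrow> vector_field M Y \<Longrightarrow>
    smooth_fun M (\<lambda>p. g p (X p) (Y p))"
  by (simp add: singular_metric_def)

lemma metric_zero:
  assumes g: "singular_metric M g" and p: "p \<in> mcarrier M" and w: "w \<in> tangent_space M p"
  shows "g p (\<lambda>_. 0) w = 0" and "g p w (\<lambda>_. 0) = 0"
proof -
  show "g p (\<lambda>_. 0) w = 0"
    using metric_linear[OF g p w w w, of 0 0] by simp
  then show "g p w (\<lambda>_. 0) = 0"
    using metric_sym[OF g p w zero_in_tangent_space] by simp
qed

lemma koszul_zero: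
  assumes M: "charted M" and g: "singular_metric M g" and p: "p \<in> mcarrier M"
    and X: "vector_field M X" and Y: "vector_field M Y"
  shows "koszul g (\<lambda>_ _. 0) X Y p = 0" and "koszul g X (\<lambda>_ _. 0) Y p = 0"
    and "koszul g X Y (\<lambda>_ _. 0) p = 0"
proof -
  have zero: "v (\<lambda>m. g m (T m) (\<lambda>_. 0)) = 0" "v (\<lambda>m. g m (\<lambda>_. 0) (T m)) = 0"
    if v: "v \<in> tangent_space M p" and T: "vector_field M T" for v T
  proof -
    have "v (\<lambda>m. g m (T m) (\<lambda>_. 0)) = v (\<lambda>_. 0)" "v (\<lambda>m. g m (\<lambda>_. 0) (T m)) = v (\<lambda>_. 0)"
      by (rule tangent_cong[OF M p v]; rule metric_zero[OF g _ vector_field_tangent[OF T]]; assumption)+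
    then show "v (\<lambda>m. g m (T m) (\<lambda>_. 0)) = 0" "v (\<lambda>m. g m (\<lambda>_. 0) (T m)) = 0"
      by (simp_all add: tangent_const[OF M v])
  qed
  note facts = zero vector_field_tangent p X Y metric_zero[OF g p] lie_bracket_zero[OF M]
    lie_bracket_tangent[OF M]
  show "koszul g (\<lambda>_ _. 0) X Y p = 0" "koszul g X (\<lambda>_ _. 0) Y p = 0"
    "koszul g X Y (\<lambda>_ _. 0) p = 0"
    by (simp_all add: koszul_def facts)
qed


section \<open>Split vector fields on a product\<close>

definition splits_into ::
  "('m, 'e::real_normed_vector) manifold \<Rightarrow> ('n, 'f::real_normed_vector) manifold
     \<Rightarrow> ('m \<times> 'n \<Rightarrow> ('m \<times> 'n) tvec) \<Rightarrow> ('m \<Rightarrow> 'm tvec) \<Rightarrow> ('n \<Rightarrow> 'n tvec) \<Rightarrow> bool"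
where
  "splits_into B F A A\<^sub>1 A\<^sub>2 \<longleftrightarrow>
     vector_field B A\<^sub>1 \<and> vector_field F A\<^sub>2 \<and>
     (\<forall>z \<in> mcarrier B \<times> mcarrier F.
        A z \<in> tangent_space (prod_manifold B F) z \<and>
        differential B fst (A z) = A\<^sub>1 (fst z) \<and> differential F snd (A z) = A\<^sub>2 (snd z))"

lemma splits_intoD:
  assumes "splits_into B F A A\<^sub>1 A\<^sub>2"
  shows "vector_field B A\<^sub>1" and "vector_field F A\<^sub>2"
    and "z \<in> mcarrier (prod_manifold B F) \<Longrightarrow> A z \<in> tangent_space (prod_manifold B F) z"
    and "z \<in> mcarrier (prod_manifold B F) \<Longrightarrow> differential B fst (A z) = A\<^sub>1 (fst z)"
    and "z \<in> mcarrier (prod_manifold B F) \<Longrightarrow> differential F snd (A z) = A\<^sub>2 (snd z)"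
  using assms unfolding splits_into_def mcarrier_prod by blast+

lemma splits_into_lift_fst:
  assumes B: "charted B" and F: "charted F" and X: "vector_field B X"
  shows "splits_into B F (lift_fst B F X) X (\<lambda>_ _. 0)"
  unfolding splits_into_def
proof (intro conjI ballI)
  fix z
  assume "z \<in> mcarrier B \<times> mcarrier F"
  then obtain p q where z: "z = (p, q)" and p: "p \<in> mcarrier B" and q: "q \<in> mcarrier F"
    by auto
  note Xp = vector_field_tangent[OF X p]
  show "lift_fst B F X z \<in> tangent_space (prod_manifold B F) z"
    using differential_tangent[OF charted_prod[OF B F] Xp, of "\<lambda>x. (x, q)"]
      smooth_fun_slice_fst[OF B F _ q] by (simp add: lift_fst_def z)
  show "differential B fst (lift_fst B F X z) = X (fst z)"
    using differential_compose[OF smooth_fun_fst[OF B F], where N=B and \<iota>="\<lambda>x. (x, q)" and v="X p"] differential_id[OF Xp]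
    by (simp add: lift_fst_def z o_def)
  show "differential F snd (lift_fst B F X z) = (\<lambda>_. 0)"
    using differential_compose[OF smooth_fun_snd[OF B F], where N=F and \<iota>="\<lambda>x. (x, q)" and v="X p"]
      differential_const[OF B Xp] by (simp add: lift_fst_def z o_def)
qed (use X vector_field_zero[OF F] in auto)

lemma splits_into_lift_snd:
  assumes B: "charted B" and F: "charted F" and V: "vector_field F V"
  shows "splits_into B F (lift_snd B F V) (\<lambda>_ _. 0) V"
  unfolding splits_into_def
proof (intro conjI ballI)
  fix z
  assume "z \<in> mcarrier B \<times> mcarrier F"
  then obtain p q where z: "z = (p, q)" and p: "p \<in> mcarrier B" and q: "q \<in> mcarrier F"
    by auto
  note Vq = vector_field_tangent[OF V q]
  show "lift_snd B F V z \<in> tangent_space (prod_manifold B F) z"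
    using differential_tangent[OF charted_prod[OF B F] Vq, of "\<lambda>y. (p, y)"]
      smooth_fun_slice_snd[OF B F _ p] by (simp add: lift_snd_def z)
  show "differential F snd (lift_snd B F V z) = V (snd z)"
    using differential_compose[OF smooth_fun_snd[OF B F], where N=F and \<iota>="\<lambda>y. (p, y)" and v="V q"] differential_id[OF Vq]
    by (simp add: lift_snd_def z o_def)
  show "differential B fst (lift_snd B F V z) = (\<lambda>_. 0)"
    using differential_compose[OF smooth_fun_fst[OF B F], where N=B and \<iota>="\<lambda>y. (p, y)" and v="V q"]
      differential_const[OF F Vq] by (simp add: lift_snd_def z o_def)
qed (use V vector_field_zero[OF B] in auto)

lemma twisted_metric_split:
  assumes "splits_into B F A A\<^sub>1 A\<^sub>2" and "splits_into B F C C\<^sub>1 C\<^sub>2"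
    and "z \<in> mcarrier (prod_manifold B F)"
  shows "twisted_metric B gB F gF b z (A z) (C z)
    = gB (fst z) (A\<^sub>1 (fst z)) (C\<^sub>1 (fst z)) + (b z)\<^sup>2 * gF (snd z) (A\<^sub>2 (snd z)) (C\<^sub>2 (snd z))"
  using splits_intoD[OF assms(1)] splits_intoD[OF assms(2)] assms(3)
  by (simp add: twisted_metric_def)

lemma twisted_metric_lie_bracket:
  assumes B: "charted B" and F: "charted F"
    and A: "splits_into B F A A\<^sub>1 A\<^sub>2" and C: "splits_into B F C C\<^sub>1 C\<^sub>2" and D: "splits_into B F D D\<^sub>1 D\<^sub>2"
    and z: "z \<in> mcarrier (prod_manifold B F)"
  shows "twisted_metric B gB F gF b z (A z) (lie_bracket C D z)
    = gB (fst z) (A\<^sub>1 (fst z)) (lie_bracket C\<^sub>1 D\<^sub>1 (fst z))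
      + (b z)\<^sup>2 * gF (snd z) (A\<^sub>2 (snd z)) (lie_bracket C\<^sub>2 D\<^sub>2 (snd z))"
proof -
  note As = splits_intoD[OF A] and Cs = splits_intoD[OF C] and Ds = splits_intoD[OF D]
  have "differential B fst (lie_bracket C D z) = lie_bracket C\<^sub>1 D\<^sub>1 (fst z)"
    by (rule differential_lie_bracket[OF charted_prod[OF B F] B z smooth_fun_fst[OF B F]])
      (use Cs Ds in \<open>auto simp: mcarrier_prod\<close>)
  moreover have "differential F snd (lie_bracket C D z) = lie_bracket C\<^sub>2 D\<^sub>2 (snd z)"
    by (rule differential_lie_bracket[OF charted_prod[OF B F] F z smooth_fun_snd[OF B F]])
      (use Cs Ds in \<open>auto simp: mcarrier_prod\<close>)
  ultimately show ?thesis
    using As z by (simp add: twisted_metric_def)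
qed

text \<open>
  On the carrier the metric coefficient is \<open>f \<circ> fst + b\<^sup>2 \<cdot> (h \<circ> snd)\<close> with \<open>f\<close> and \<open>h\<close> smooth on the
  factors. This is the product rule for it, where \<open>A\<close> acts on the two pullbacks through its
  components.
\<close>

lemma derivative_twisted_metric:
  assumes B: "charted B" and F: "charted F"
    and gB: "singular_metric B gB" and gF: "singular_metric F gF"
    and b: "smooth_fun (prod_manifold B F) b"
    and A: "splits_into B F A A\<^sub>1 A\<^sub>2" and C: "splits_into B F C C\<^sub>1 C\<^sub>2" and D: "splits_into B F D D\<^sub>1 D\<^sub>2"
    and p: "p \<in> mcarrier B" and q: "q \<in> mcarrier F"
  shows "A (p, q) (\<lambda>m. twisted_metric B gB F gF b m (C m) (D m))
    = A\<^sub>1 p (\<lambda>m. gB m (C\<^sub>1 m) (D\<^sub>1 m))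
      + 2 * b (p, q) * A (p, q) b * gF q (C\<^sub>2 q) (D\<^sub>2 q)
      + (b (p, q))\<^sup>2 * A\<^sub>2 q (\<lambda>m. gF m (C\<^sub>2 m) (D\<^sub>2 m))"
proof -
  let ?M = "prod_manifold B F" and ?v = "A (p, q)"
  define f where "f = (\<lambda>m. gB m (C\<^sub>1 m) (D\<^sub>1 m))"
  define h where "h = (\<lambda>m. gF m (C\<^sub>2 m) (D\<^sub>2 m))"
  note M = charted_prod[OF B F]
  have z: "(p, q) \<in> mcarrier ?M"
    using p q by (simp add: mcarrier_prod)
  note As = splits_intoD[OF A] and Cs = splits_intoD[OF C] and Ds = splits_intoD[OF D]
  note v = As(3)[OF z]
  have f: "smooth_fun B f" and h: "smooth_fun F h"
    unfolding f_def h_def using metric_smooth[OF gB] metric_smooth[OF gF] Cs Ds by blast+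
  have f': "smooth_fun ?M (f \<circ> fst)" and h': "smooth_fun ?M (h \<circ> snd)"
    using smooth_fun_fst[OF B F f] smooth_fun_snd[OF B F h] .
  have bb: "smooth_fun ?M (\<lambda>m. b m * b m)"
    by (rule smooth_fun_mult[OF M b b])
  have vf: "?v (f \<circ> fst) = A\<^sub>1 p f"
    using fun_cong[OF As(4)[OF z], of f] f by (simp add: differential_def)
  have vh: "?v (h \<circ> snd) = A\<^sub>2 q h"
    using fun_cong[OF As(5)[OF z], of h] h by (simp add: differential_def)
  have "?v (\<lambda>m. twisted_metric B gB F gF b m (C m) (D m))
      = ?v (\<lambda>m. 1 * (f \<circ> fst) m + 1 * ((b m * b m) * (h \<circ> snd) m))"
    by (rule tangent_cong[OF M z v])
      (simp add: twisted_metric_split[OF C D] f_def h_def power2_eq_square)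
  also have "\<dots> = 1 * ?v (f \<circ> fst) + 1 * ?v (\<lambda>m. (b m * b m) * (h \<circ> snd) m)"
    by (rule tangent_linear[OF v f' smooth_fun_mult[OF M bb h']])
  also have "\<dots> = A\<^sub>1 p f + 2 * b (p, q) * ?v b * h q + (b (p, q))\<^sup>2 * A\<^sub>2 q h"
    unfolding tangent_mult[OF v bb h'] tangent_mult[OF v b b] vf vh
    by (simp add: algebra_simps power2_eq_square)
  finally show ?thesis
    by (simp add: f_def h_def)
qed

text \<open>
  Everything in the Koszul form is additive over the two factors except the derivatives of \<open>b\<^sup>2\<close>,
  which contribute the terms with a factor \<open>b\<close>.
\<close>

lemma koszul_twisted:
  assumes B: "charted B" and F: "charted F"
    and gB: "singular_metric B gB" and gF: "singular_metric F gF"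
    and b: "smooth_fun (prod_manifold B F) b"
    and A: "splits_into B F A A\<^sub>1 A\<^sub>2" and C: "splits_into B F C C\<^sub>1 C\<^sub>2" and D: "splits_into B F D D\<^sub>1 D\<^sub>2"
    and p: "p \<in> mcarrier B" and q: "q \<in> mcarrier F"
  shows "koszul (twisted_metric B gB F gF b) A C D (p, q)
    = koszul gB A\<^sub>1 C\<^sub>1 D\<^sub>1 p + (b (p, q))\<^sup>2 * koszul gF A\<^sub>2 C\<^sub>2 D\<^sub>2 q
      + b (p, q) * A (p, q) b * gF q (C\<^sub>2 q) (D\<^sub>2 q)
      + b (p, q) * C (p, q) b * gF q (D\<^sub>2 q) (A\<^sub>2 q)
      - b (p, q) * D (p, q) b * gF q (A\<^sub>2 q) (C\<^sub>2 q)"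
proof -
  have z: "(p, q) \<in> mcarrier (prod_manifold B F)"
    using p q by (simp add: mcarrier_prod)
  note deriv = derivative_twisted_metric[OF B F gB gF b _ _ _ p q]
  note brack = twisted_metric_lie_bracket[OF B F _ _ _ z]
  show ?thesis
    unfolding koszul_def
      deriv[OF A C D] deriv[OF C D A] deriv[OF D A C]
      brack[OF A C D] brack[OF C D A] brack[OF D A C]
    by (simp add: algebra_simps)
qed

theorem proposition5p7:
  fixes B :: "('m, 'e::real_normed_vector) manifold" and gB :: "'m form2"
    and F :: "('n, 'f::real_normed_vector) manifold" and gF :: "'n form2"
    and b :: "'m \<times> 'n \<Rightarrow> real"
    and P X Y Z :: "'m \<Rightarrow> 'm tvec" and U V W :: "'n \<Rightarrow> 'n tvec"
  defines "K \<equiv> ssm_koszul (twisted_metric B gB F gF b) (lift_fst B F P)"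
    and "X' \<equiv> lift_fst B F X" and "Y' \<equiv> lift_fst B F Y" and "Z' \<equiv> lift_fst B F Z"
    and "U' \<equiv> lift_snd B F U" and "V' \<equiv> lift_snd B F V" and "W' \<equiv> lift_snd B F W"
  assumes "singular_semi_Riemannian B gB" and "singular_semi_Riemannian F gF"
    and "smooth_fun (prod_manifold B F) b"
    and "vector_field B P"
    and "vector_field B X" and "vector_field B Y" and "vector_field B Z"
    and "vector_field F U" and "vector_field F V" and "vector_field F W"
  shows "\<forall>p \<in> mcarrier B. \<forall>q \<in> mcarrier F.
      K X' Y' Z' (p, q) = ssm_koszul gB P X Y Z p \<and>
      (K X' Y' W' (p, q) = 0 \<and> K X' W' Y' (p, q) = 0 \<and> K W' X' Y' (p, q) = 0) \<and>
      K X' V' W' (p, q) = b (p, q) * X' (p, q) b * gF q (V q) (W q) \<and>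
      (K V' X' W' (p, q) = - K V' W' X' (p, q) \<and>
       - K V' W' X' (p, q) = b (p, q) * X' (p, q) b * gF q (V q) (W q)
          + (b (p, q))\<^sup>2 * gB p (X p) (P p) * gF q (V q) (W q)) \<and>
      K U' V' W' (p, q) =
        b (p, q) * U' (p, q) b * gF q (V q) (W q)
        + b (p, q) * V' (p, q) b * gF q (W q) (U q)
        - b (p, q) * W' (p, q) b * gF q (U q) (V q)
        + (b (p, q))\<^sup>2 * koszul gF U V W q"
proof (intro ballI)
  fix p q
  assume p: "p \<in> mcarrier B" and q: "q \<in> mcarrier F"
  have B: "charted B" and F: "charted F" and gB: "singular_metric B gB" and gF: "singular_metric F gF"
    using assms(8,9) smooth_manifold_charted by (auto simp: singular_semi_Riemannian_def)
  have z: "(p, q) \<in> mcarrier (prod_manifold B F)"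
    using p q by (simp add: mcarrier_prod)
  note fields = \<open>vector_field B P\<close> \<open>vector_field B X\<close> \<open>vector_field B Y\<close> \<open>vector_field B Z\<close>
    \<open>vector_field F U\<close> \<open>vector_field F V\<close> \<open>vector_field F W\<close>
  have lifts: "splits_into B F (lift_fst B F P) P (\<lambda>_ _. 0)"
    "splits_into B F X' X (\<lambda>_ _. 0)" "splits_into B F Y' Y (\<lambda>_ _. 0)" "splits_into B F Z' Z (\<lambda>_ _. 0)"
    "splits_into B F U' (\<lambda>_ _. 0) U" "splits_into B F V' (\<lambda>_ _. 0) V" "splits_into B F W' (\<lambda>_ _. 0) W"
    unfolding X'_def Y'_def Z'_def U'_def V'_def W'_def
    using fields by (auto intro: splits_into_lift_fst[OF B F] splits_into_lift_snd[OF B F])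
  have K: "K A C D (p, q)
      = koszul gB A\<^sub>1 C\<^sub>1 D\<^sub>1 p + (b (p, q))\<^sup>2 * koszul gF A\<^sub>2 C\<^sub>2 D\<^sub>2 q
        + b (p, q) * A (p, q) b * gF q (C\<^sub>2 q) (D\<^sub>2 q)
        + b (p, q) * C (p, q) b * gF q (D\<^sub>2 q) (A\<^sub>2 q)
        - b (p, q) * D (p, q) b * gF q (A\<^sub>2 q) (C\<^sub>2 q)
        + (gB p (C\<^sub>1 p) (P p) + (b (p, q))\<^sup>2 * gF q (C\<^sub>2 q) (\<lambda>_. 0))
          * (gB p (A\<^sub>1 p) (D\<^sub>1 p) + (b (p, q))\<^sup>2 * gF q (A\<^sub>2 q) (D\<^sub>2 q))
        - (gB p (A\<^sub>1 p) (C\<^sub>1 p) + (b (p, q))\<^sup>2 * gF q (A\<^sub>2 q) (C\<^sub>2 q))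
          * (gB p (P p) (D\<^sub>1 p) + (b (p, q))\<^sup>2 * gF q (\<lambda>_. 0) (D\<^sub>2 q))"
    if "splits_into B F A A\<^sub>1 A\<^sub>2" "splits_into B F C C\<^sub>1 C\<^sub>2" "splits_into B F D D\<^sub>1 D\<^sub>2"
    for A C D A\<^sub>1 A\<^sub>2 C\<^sub>1 C\<^sub>2 D\<^sub>1 D\<^sub>2
    unfolding K_def ssm_koszul_def
    using koszul_twisted[OF B F gB gF \<open>smooth_fun (prod_manifold B F) b\<close> that p q]
      twisted_metric_split[OF that(2) lifts(1) z] twisted_metric_split[OF that(1,3) z]
      twisted_metric_split[OF that(1,2) z] twisted_metric_split[OF lifts(1) that(3) z]
    by simp
  have tangent: "P p \<in> tangent_space B p" "X p \<in> tangent_space B p" "Y p \<in> tangent_space B p"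
    "Z p \<in> tangent_space B p" "U q \<in> tangent_space F q" "V q \<in> tangent_space F q"
    "W q \<in> tangent_space F q"
    by (simp_all add: vector_field_tangent fields p q)
  note zeros = metric_zero[OF gB p] metric_zero[OF gF q] zero_in_tangent_space tangent
    koszul_zero[OF B gB p] koszul_zero[OF F gF q] vector_field_zero[OF B] vector_field_zero[OF F] fields
  have sym: "gB p (P p) (X p) = gB p (X p) (P p)" "gF q (W q) (V q) = gF q (V q) (W q)"
    using metric_sym[OF gB p tangent(1,2)] metric_sym[OF gF q tangent(7,6)] .
  have base: "K X' Y' Z' (p, q) = ssm_koszul gB P X Y Z p"
    by (simp add: K[OF lifts(2,3,4)] zeros ssm_koszul_def)
  have mixed: "K X' Y' W' (p, q) = 0" "K X' W' Y' (p, q) = 0" "K W' X' Y' (p, q) = 0"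
    by (simp_all add: K[OF lifts(2,3,7)] K[OF lifts(2,7,3)] K[OF lifts(7,2,3)] zeros)
  have XVW: "K X' V' W' (p, q) = b (p, q) * X' (p, q) b * gF q (V q) (W q)"
    by (simp add: K[OF lifts(2,6,7)] zeros)
  have VXW: "K V' X' W' (p, q) = b (p, q) * X' (p, q) b * gF q (V q) (W q)
      + (b (p, q))\<^sup>2 * gB p (X p) (P p) * gF q (V q) (W q)"
    by (simp add: K[OF lifts(6,2,7)] zeros sym)
  have VWX: "- K V' W' X' (p, q) = b (p, q) * X' (p, q) b * gF q (V q) (W q)
      + (b (p, q))\<^sup>2 * gB p (X p) (P p) * gF q (V q) (W q)"
    by (simp add: K[OF lifts(6,7,2)] zeros sym)
  have UVW: "K U' V' W' (p, q) =
      b (p, q) * U' (p, q) b * gF q (V q) (W q)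
      + b (p, q) * V' (p, q) b * gF q (W q) (U q)
      - b (p, q) * W' (p, q) b * gF q (U q) (V q)
      + (b (p, q))\<^sup>2 * koszul gF U V W q"
    by (simp add: K[OF lifts(5,6,7)] zeros)
  show "K X' Y' Z' (p, q) = ssm_koszul gB P X Y Z p \<and>
      (K X' Y' W' (p, q) = 0 \<and> K X' W' Y' (p, q) = 0 \<and> K W' X' Y' (p, q) = 0) \<and>
      K X' V' W' (p, q) = b (p, q) * X' (p, q) b * gF q (V q) (W q) \<and>
      (K V' X' W' (p, q) = - K V' W' X' (p, q) \<and>
       - K V' W' X' (p, q) = b (p, q) * X' (p, q) b * gF q (V q) (W q)
          + (b (p, q))\<^sup>2 * gB p (X p) (P p) * gF q (V q) (W q)) \<and>
      K U' V' W' (p, q) =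
        b (p, q) * U' (p, q) b * gF q (V q) (W q)
        + b (p, q) * V' (p, q) b * gF q (W q) (U q)
        - b (p, q) * W' (p, q) b * gF q (U q) (V q)
        + (b (p, q))\<^sup>2 * koszul gF U V W q"
    using base mixed XVW VXW VWX UVW by simp
qed

end
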